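(* Let $1\le k\le L$. Define the differential operator $\mathcal S_k^{-1}$ by $$(\mathcal S_k^{-1}f)(x_1,\dots,x_k)=(-1)^{\frac{k(k-1)}2}\,\phi_\delta(x_1,\dots,x_k)^{-1}\,\det\big[D_{x_i}^{2(k-j)}\big]_{i,j=1}^k\Big(\prod_{i=1}^k\phi_\delta(x_i)\; f(x_1,\dots,x_k)\Big).$$ Then for every partition $\lambda=(\lambda_1\ge\dots\ge\lambda_L\ge0)$, $$\mathcal S_k^{-1}\prod_{i=1}^kq_\lambda(x_i)=\frac{\chi_\lambda(x_1,\dots,x_k,1,\dots,1)}{\chi_\lambda(1,\dots,1)} .$$
   Context: $D_x=x\,\partial/\partial x$. $\delta=(L,L-1,\dots,1)$ and $\mu=\lambda+\delta$, i.e. $\mu_i=\lambda_i+L-i+1$. For a strictly decreasing sequence $\mu$ of $L$ positive integers, $a_\mu(x_1,\dots,x_L)=\det[x_i^{\mu_j}-x_i^{-\mu_j}]_{i,j=1}^L$, and for $1\le m\le L+1$, $a^{(m)}_\mu(x_1,\dots,x_{m-1})$ is the determinant of the $L\times L$ matrix whose $(i,j)$ entry is $x_i^{\mu_j}-x_i^{-\mu_j}$ for $i<m$ and $\mu_j^{2(L-i)+1}$ for $i\ge m$ (so $a^{(L+1)}_\mu=a_\mu$). The symplectic character in $L$ variables is $\chi_\lambda=a_{\lambda+\delta}/a_\delta$ (a Laurent polynomial). Set $\phi_\mu(x_1,\dots,x_m)=a^{(m+1)}_\mu(x_1,\dots,x_m)/a^{(1)}_\mu$, and $q_\lambda(z)=\chi_\lambda(z,1,\dots,1)/\chi_\lambda(1,\dots,1)$.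 The operators $D_{x_i}$ commute, so the determinant is well defined. *)

theory Defs
  imports
    "HOL-Library.Poly_Mapping"
    "HOL-Combinatorics.Permutations"
    "HOL-Analysis.Derivative"
    "Jordan_Normal_Form.Determinant"
begin

text \<open>
  Indices are shifted by one throughout: the variables \<open>x\<^sub>1, x\<^sub>2, \<dots>\<close> are \<open>x 0, x 1, \<dots>\<close>, and the
  parts \<open>\<mu>\<^sub>1, \<dots>, \<mu>\<^sub>L\<close> are \<open>\<mu> 0, \<dots>, \<mu> (L - 1)\<close>. A function of finitely many variables is a
  function on \<^typ>\<open>nat \<Rightarrow> complex\<close> that ignores the remaining coordinates.
\<close>

type_synonym fn = "(nat \<Rightarrow> complex) \<Rightarrow> complex"

text \<open>Laurent polynomials: finitely supported families of coefficients, indexed by integer exponents.\<close>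

type_synonym laurent = "(nat \<Rightarrow>\<^sub>0 int) \<Rightarrow>\<^sub>0 complex"

definition laurent_eval :: "laurent \<Rightarrow> fn" where
  "laurent_eval p x =
     (\<Sum>e\<in>Poly_Mapping.keys p. Poly_Mapping.lookup p e *
        (\<Prod>i\<in>Poly_Mapping.keys e. x i powi Poly_Mapping.lookup e i))"

definition delta :: "nat \<Rightarrow> nat \<Rightarrow> nat" where
  "delta L j = L - j"

definition a_mixed :: "nat \<Rightarrow> nat \<Rightarrow> (nat \<Rightarrow> nat) \<Rightarrow> fn" where
  "a_mixed L m \<mu> x = Determinant.det (Matrix.mat L L (\<lambda>(i, j).
     if Suc i < m then x i powi int (\<mu> j) - x i powi (- int (\<mu> j))
     else of_nat (\<mu> j) ^ (2 * (L - Suc i) + 1)))"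

definition a_full :: "nat \<Rightarrow> (nat \<Rightarrow> nat) \<Rightarrow> fn" where
  "a_full L \<mu> x = Determinant.det (Matrix.mat L L (\<lambda>(i, j).
     x i powi int (\<mu> j) - x i powi (- int (\<mu> j))))"

text \<open>
  The quotient \<open>a\<^bsub>\<lambda>+\<delta>\<^esub> / a\<^bsub>\<delta>\<^esub>\<close> as a Laurent polynomial, so that it may be evaluated at points where
  \<open>a\<^bsub>\<delta>\<^esub>\<close> vanishes, such as \<open>(1, \<dots>, 1)\<close>. The condition is imposed on all coordinates of \<open>x\<close>,
  also those from \<open>L\<close> on, so that it determines the Laurent polynomial uniquely.
\<close>

definition sympl_char :: "nat \<Rightarrow> (nat \<Rightarrow> nat) \<Rightarrow> laurent" where
  "sympl_char L lam = (THE p. \<forall>x. (\<forall>i. x i \<noteq> 0) \<and> a_full L (delta L) x \<noteq> 0 \<longrightarrow>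
     laurent_eval p x = a_full L (\<lambda>j. lam j + delta L j) x / a_full L (delta L) x)"

text \<open>\<open>\<phi>\<^bsub>\<mu>\<^esub>(x\<^sub>1, \<dots>, x\<^sub>m)\<close>; the denominator involves no variables.\<close>

definition phi :: "nat \<Rightarrow> (nat \<Rightarrow> nat) \<Rightarrow> nat \<Rightarrow> fn" where
  "phi L \<mu> m x = a_mixed L (m + 1) \<mu> x / a_mixed L 1 \<mu> x"

definition q_char :: "nat \<Rightarrow> (nat \<Rightarrow> nat) \<Rightarrow> complex \<Rightarrow> complex" where
  "q_char L lam z = laurent_eval (sympl_char L lam) (\<lambda>i. if i = 0 then z else 1)
                    / laurent_eval (sympl_char L lam) (\<lambda>i. 1)"

definition euler_D :: "nat \<Rightarrow> fn \<Rightarrow> fn" where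
  "euler_D i f x = x i * deriv (\<lambda>z. f (x(i := z))) (x i)"

text \<open>
  Leibniz determinant of a \<open>k \<times> k\<close> matrix of operators; in each term the operator of row \<open>0\<close> is the
  outermost one. The order is immaterial when operators from different rows commute.
\<close>

definition op_det :: "nat \<Rightarrow> (nat \<Rightarrow> nat \<Rightarrow> fn \<Rightarrow> fn) \<Rightarrow> fn \<Rightarrow> fn" where
  "op_det k T f x =
     (\<Sum>\<pi> | \<pi> permutes {0..<k}. of_int (sign \<pi>) * foldr (\<lambda>i. T i (\<pi> i)) [0..<k] f x)"

definition S_inv :: "nat \<Rightarrow> nat \<Rightarrow> fn \<Rightarrow> fn" where
  "S_inv L k f x = (-1) ^ (k * (k - 1) div 2) * inverse (phi L (delta L) k x) *
     op_det k (\<lambda>i j. euler_D i ^^ (2 * (k - Suc j)))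
       (\<lambda>y. (\<Prod>i<k. phi L (delta L) 1 (\<lambda>_. y i)) * f y) x"

end

theory Submission
  imports Defs
begin

text \<open>
  Put \<open>\<mu> = \<lambda> + \<delta>\<close> and \<open>w = z + 1/z - 2\<close>. The function \<open>z^m - z^(-m)\<close> is \<open>z - 1/z\<close> times a monic
  polynomial of degree \<open>m - 1\<close> in \<open>w\<close>, whose Taylor coefficients at \<open>w = 0\<close> are odd polynomials in \<open>m\<close>.
  Newton interpolation in \<open>w\<close> therefore factors the matrix of every mixed determinant in \<open>\<mu>\<close> as
  \<open>Z H(\<mu>)\<close>, where \<open>Z\<close> does not depend on \<open>\<mu>\<close> and \<open>det H(\<delta>) = 1\<close>. Hence the character is the Laurent
  polynomial \<open>det H(\<mu>)\<close>, and its value at \<open>(x 1, \<dots>, x k, 1, \<dots>, 1)\<close> is the ratio of the mixed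
  determinants of \<open>\<mu>\<close> and \<open>\<delta>\<close> without any limit being taken. Up to a reversal of columns, the theorem
  thus reduces to \<open>det [D^(2 m) \<phi>(x i)] = \<phi>(x 1, \<dots>, x k)\<close> with \<open>0 \<le> m < k\<close> and \<open>\<phi> = \<phi>\<^sub>\<mu>\<close>. Expanding
  \<open>\<phi>(z) = \<Sum>l. A l (z^(\<mu> l) - z^(-\<mu> l))\<close>, this follows by multiplying the matrices of the mixed
  determinants with \<open>k\<close> and with no variables by \<open>[A l (\<mu> l)^(2 m)]\<close>: the products are block triangular,
  and unitriangular in the rows without variables.
\<close>

subsection \<open>Determinants and Newton interpolation\<close>

lemma det_mat_mult:
  fixes A Z H :: "nat \<Rightarrow> nat \<Rightarrow> 'a::comm_ring_1"
  assumes "\<And>i j. i < n \<Longrightarrow> j < n \<Longrightarrow> A i j = (\<Sum>l<n. Z i l * H l j)"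
  shows "Determinant.det (Matrix.mat n n (\<lambda>(i, j). A i j)) =
    Determinant.det (Matrix.mat n n (\<lambda>(i, j). Z i j)) *
    Determinant.det (Matrix.mat n n (\<lambda>(i, j). H i j))"
proof -
  have "Matrix.mat n n (\<lambda>(i, j). A i j) =
      Matrix.mat n n (\<lambda>(i, j). Z i j) * Matrix.mat n n (\<lambda>(i, j). H i j)"
    by (rule eq_matI) (auto simp: assms scalar_prod_def atLeast0LessThan)
  then show ?thesis
    by (simp add: det_mult[where n = n])
qed

lemma det_mat_upper_triangular:
  fixes A :: "nat \<Rightarrow> nat \<Rightarrow> 'a::comm_ring_1"
  assumes "\<And>i j. i < n \<Longrightarrow> j < i \<Longrightarrow> A i j = 0"
  shows "Determinant.det (Matrix.mat n n (\<lambda>(i, j). A i j)) = (\<Prod>i<n. A i i)"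
proof -
  have "Determinant.det (Matrix.mat n n (\<lambda>(i, j). A i j)) =
      prod_list (diag_mat (Matrix.mat n n (\<lambda>(i, j). A i j)))"
    by (rule det_upper_triangular[where n = n]) (auto simp: assms)
  also have "\<dots> = (\<Prod>i<n. A i i)"
    by (auto simp: prod_list_diag_prod atLeast0LessThan intro!: prod.cong)
  finally show ?thesis .
qed

lemma det_mat_lower_triangular:
  fixes A :: "nat \<Rightarrow> nat \<Rightarrow> 'a::comm_ring_1"
  assumes "\<And>i j. j < n \<Longrightarrow> i < j \<Longrightarrow> A i j = 0"
  shows "Determinant.det (Matrix.mat n n (\<lambda>(i, j). A i j)) = (\<Prod>i<n. A i i)"
proof -
  have "Determinant.det (Matrix.mat n n (\<lambda>(i, j). A i j)) =
      prod_list (diag_mat (Matrix.mat n n (\<lambda>(i, j). A i j)))"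
    by (rule det_lower_triangular[where n = n]) (auto simp: assms)
  also have "\<dots> = (\<Prod>i<n. A i i)"
    by (auto simp: prod_list_diag_prod atLeast0LessThan intro!: prod.cong)
  finally show ?thesis .
qed

text \<open>The lower left block is 0 and the lower right one is upper unitriangular, hence of
  determinant 1. The case \<open>k = 0\<close> is used as well: the whole determinant is then
  1.\<close>

lemma det_mat_block_upper_triangular:
  fixes A :: "nat \<Rightarrow> nat \<Rightarrow> 'a::idom"
  assumes "k \<le> n"
    and low: "\<And>i j. k \<le> i \<Longrightarrow> i < n \<Longrightarrow> j < i \<Longrightarrow> A i j = 0"
    and diag: "\<And>i. k \<le> i \<Longrightarrow> i < n \<Longrightarrow> A i i = 1"
  shows "Determinant.det (Matrix.mat n n (\<lambda>(i, j). A i j)) =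
    Determinant.det (Matrix.mat k k (\<lambda>(i, j). A i j))"
proof -
  define m where "m = n - k"
  have n: "n = k + m" using assms(1) by (simp add: m_def)
  let ?D = "Matrix.mat m m (\<lambda>(i, j). A (k + i) (k + j))"
  have "Matrix.mat n n (\<lambda>(i, j). A i j) =
     four_block_mat (Matrix.mat k k (\<lambda>(i, j). A i j)) (Matrix.mat k m (\<lambda>(i, j). A i (k + j)))
       (0\<^sub>m m k) ?D"
    by (rule eq_matI) (auto simp: n low)
  moreover have "Determinant.det ?D = 1"
    using det_mat_upper_triangular[of m "\<lambda>i j. A (k + i) (k + j)"] by (simp add: low diag n)
  ultimately show ?thesis
    by (simp add: det_four_block_mat_lower_left_zero[where n = k and m = m])
qed

text \<open>The only nonzero entry of the first row is in the last column. Deleting both leaves the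
  matrix of the next smaller size, and the exponents of the cofactor signs add up to a triangular
  number.\<close>

lemma det_antidiagonal:
  "Determinant.det (Matrix.mat n n (\<lambda>(i, j). if Suc (i + j) = n then 1 else 0 :: 'a::comm_ring_1)) =
    (-1) ^ (n * (n - 1) div 2)"
proof (induction n)
  case 0
  show ?case by simp
next
  case (Suc n)
  define M where "M = (\<lambda>n. Matrix.mat n n (\<lambda>(i, j). if Suc (i + j) = n then 1 else 0 :: 'a))"
  have "mat_delete (M (Suc n)) 0 n = M n"
    by (rule eq_matI) (auto simp: M_def mat_delete_def)
  then have cof: "cofactor (M (Suc n)) 0 n = (-1) ^ n * (-1) ^ (n * (n - 1) div 2)"
    using Suc by (simp add: cofactor_def M_def)
  have "Determinant.det (M (Suc n)) = (\<Sum>j<Suc n. M (Suc n) $$ (0, j) * cofactor (M (Suc n)) 0 j)"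
    by (rule laplace_expansion_row) (auto simp: M_def)
  also have "\<dots> = (\<Sum>j<Suc n. if j = n then cofactor (M (Suc n)) 0 n else 0)"
    by (intro sum.cong) (auto simp: M_def)
  also have "\<dots> = (-1) ^ (n + n * (n - 1) div 2)"
    by (simp add: cof power_add)
  also have "n + n * (n - 1) div 2 = Suc n * (Suc n - 1) div 2"
    by (cases n) auto
  finally show ?case by (simp add: M_def)
qed

text \<open>Reversal is multiplication on the right by the antidiagonal permutation matrix. It
  accounts for the sign in \<open>S_inv\<close>, whose operator matrix lists the orders of
  differentiation in descending order.\<close>

lemma det_reverse_columns:
  fixes A :: "nat \<Rightarrow> nat \<Rightarrow> 'a::comm_ring_1"
  shows "Determinant.det (Matrix.mat n n (\<lambda>(i, j). A i (n - Suc j))) =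
    (-1) ^ (n * (n - 1) div 2) * Determinant.det (Matrix.mat n n (\<lambda>(i, j). A i j))"
proof -
  have "A i (n - Suc j) = (\<Sum>l<n. A i l * (if Suc (l + j) = n then 1 else 0))"
    if "j < n" for i j
  proof -
    have "(\<Sum>l<n. A i l * (if Suc (l + j) = n then 1 else 0)) =
        (\<Sum>l<n. if l = n - Suc j then A i l else 0)"
      using that by (intro sum.cong) auto
    then show ?thesis using that by simp
  qed
  then show ?thesis
    using det_mat_mult[of n "\<lambda>i j. A i (n - Suc j)" A "\<lambda>l j. if Suc (l + j) = n then 1 else 0"]
    by (simp add: det_antidiagonal mult.commute)
qed

section \<open>Divided differences by repeated synthetic division\<close>

primrec newton_quot :: "(nat \<Rightarrow> 'a::comm_ring_1) \<Rightarrow> 'a poly \<Rightarrow> nat \<Rightarrow> 'a poly" where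
  "newton_quot a p 0 = p"
| "newton_quot a p (Suc s) = synthetic_div (newton_quot a p s) (a s)"

text \<open>Each step divides the last quotient by \<open>z - a s\<close> with remainder, so
  \<open>poly (newton_quot a p s) (a s)\<close> is the divided difference of \<open>p\<close> at
  \<open>a 0, ..., a s\<close>. Nodes may repeat, since nothing is divided by differences of
  nodes.\<close>

lemma newton_expansion:
  "poly p z = (\<Sum>s<n. (\<Prod>r<s. z - a r) * poly (newton_quot a p s) (a s))
    + (\<Prod>r<n. z - a r) * poly (newton_quot a p n) z"
proof (induction n)
  case (Suc n)
  have *: "poly (newton_quot a p n) z =
      (z - a n) * poly (newton_quot a p (Suc n)) z + poly (newton_quot a p n) (a n)"
    using arg_cong[OF synthetic_div_correct'[of "a n" "newton_quot a p n"], of "\<lambda>q. poly q z"]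
    by (simp add: algebra_simps)
  then show ?case
    by (simp add: Suc * algebra_simps del: newton_quot.simps)
qed simp

text \<open>Solved for \<open>coeff (newton_quot a p (Suc s)) n\<close>, this computes the next
  quotient from its top coefficient downwards.\<close>

lemma coeff_newton_quot_Suc:
  "coeff (newton_quot a p s) (Suc n) =
    coeff (newton_quot a p (Suc s)) n - a s * coeff (newton_quot a p (Suc s)) (Suc n)"
  using arg_cong[OF synthetic_div_correct[of "newton_quot a p s" "a s"], of "\<lambda>q. coeff q (Suc n)"]
  by (simp add: algebra_simps)

lemma degree_newton_quot: "degree (newton_quot a p s) = degree p - s"
  by (induction s) (auto simp: degree_synthetic_div)

text \<open>Division by the variable drops the constant term and shifts the other
  coefficients.\<close>

lemma coeff_newton_quot_zero_nodes:
  assumes "\<And>r. r < s \<Longrightarrow> a r = 0"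
  shows "coeff (newton_quot a p s) n = coeff p (s + n)"
  using assms
proof (induction s arbitrary: n)
  case (Suc s)
  then show ?case using coeff_newton_quot_Suc[of a p s n] by simp
qed simp

text \<open>In this range the correction term of the recursion contains a coefficient beyond the
  degree, so the result is the same for all nodes.\<close>

lemma coeff_newton_quot_top:
  assumes "degree p \<le> s + n"
  shows "coeff (newton_quot a p s) n = coeff p (s + n)"
  using assms
proof (induction s arbitrary: n)
  case (Suc s)
  have "coeff (newton_quot a p (Suc s)) (Suc n) = 0"
    using Suc.prems degree_newton_quot[of a p "Suc s"] by (intro coeff_eq_0) linarith
  then show ?case
    using Suc coeff_newton_quot_Suc[of a p s n] by simp
qed simp

lemma poly_newton_quot_top:
  assumes "degree p \<le> s"
  shows "poly (newton_quot a p s) z = coeff p s"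
proof -
  have "degree (newton_quot a p s) = 0"
    using assms by (simp add: degree_newton_quot)
  then obtain c where "newton_quot a p s = [:c:]" by (metis degree_eq_zeroE)
  then show ?thesis
    using coeff_newton_quot_top[of p s 0 a] assms by simp
qed

text \<open>\<open>sinh (m t) / sinh t\<close> as a polynomial in \<open>4 (sinh (t / 2))\<^sup>2\<close>, that is, the Chebyshev polynomial
  \<open>U\<^bsub>m-1\<^esub>\<close> in a shifted variable.\<close>

definition odd_cheb :: "nat \<Rightarrow> complex poly" where
  "odd_cheb m = (\<Sum>n<m. monom (of_nat ((m + n) choose (2 * n + 1))) n)"

lemma coeff_odd_cheb: "coeff (odd_cheb m) n = of_nat ((m + n) choose (2 * n + 1))"
  by (auto simp: odd_cheb_def coeff_sum not_less)

lemma degree_odd_cheb_le: "degree (odd_cheb m) \<le> m - 1"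
  by (rule degree_le) (auto simp: coeff_odd_cheb)

lemma odd_cheb_0: "odd_cheb 0 = 0" and odd_cheb_1: "odd_cheb (Suc 0) = 1"
  by (simp_all add: odd_cheb_def)

text \<open>The three-term recurrence of the Chebyshev polynomials in the shifted variable; on
  coefficients it is Pascal's rule, applied repeatedly.\<close>

lemma odd_cheb_rec: "odd_cheb (Suc (Suc m)) = [:2, 1:] * odd_cheb (Suc m) - odd_cheb m"
proof (rule poly_eqI)
  fix n
  show "coeff (odd_cheb (Suc (Suc m))) n = coeff ([:2, 1:] * odd_cheb (Suc m) - odd_cheb m) n"
  proof (cases n)
    case 0
    then show ?thesis by (simp add: coeff_odd_cheb)
  next
    case (Suc l)
    then show ?thesis by (simp add: coeff_odd_cheb)
  qed
qed

text \<open>Both sides satisfy \<open>f (m + 2) = (z + inverse z) * f (m + 1) - f m\<close> and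
  agree for \<open>m = 0\<close> and \<open>m = 1\<close>.\<close>

lemma diff_inverse_power_eq_odd_cheb:
  assumes "z \<noteq> 0"
  shows "z ^ m - inverse z ^ m = (z - inverse z) * poly (odd_cheb m) (z + inverse z - 2)"
proof (induction m rule: induct_nat_012)
  case (ge2 n)
  have "z ^ Suc (Suc n) - inverse z ^ Suc (Suc n) =
      (z + inverse z) * (z ^ Suc n - inverse z ^ Suc n) - (z ^ n - inverse z ^ n)"
    using assms by (simp add: field_simps)
  also have "\<dots> = (z - inverse z) * ((z + inverse z) * poly (odd_cheb (Suc n)) (z + inverse z - 2) -
      poly (odd_cheb n) (z + inverse z - 2))"
    by (simp only: ge2) (simp add: algebra_simps)
  also have "\<dots> = (z - inverse z) * poly (odd_cheb (Suc (Suc n))) (z + inverse z - 2)"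
    by (simp add: odd_cheb_rec algebra_simps)
  finally show ?case .
qed (simp_all add: odd_cheb_0 odd_cheb_1)

text \<open>These are the central factorial numbers T(2n+2, 2r+2) times the factorial of 2r+1. The
  factor \<open>2 * r\<close> removes the truncated index \<open>r - 1\<close> at
  \<open>r = 0\<close>.\<close>

fun central_factorial :: "nat \<Rightarrow> nat \<Rightarrow> nat" where
  "central_factorial 0 r = (if r = 0 then 1 else 0)"
| "central_factorial (Suc n) r = 2 * r * (2 * r + 1) * central_factorial n (r - 1)
     + (r + 1)\<^sup>2 * central_factorial n r"

lemma central_factorial_eq_0: "n < r \<Longrightarrow> central_factorial n r = 0"
  by (induction n arbitrary: r) auto

text \<open>The binomial is m (m^2 - 1) ... (m^2 - r^2) divided by the factorial of 2r+1. Splitting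
  m^2 as (m^2 - (r+1)^2) + (r+1)^2, the first summand supplies the next factor. The case
  \<open>m \<le> r\<close> is separate because of the subtraction of natural numbers.\<close>

lemma square_times_binomial:
  "m\<^sup>2 * ((m + r) choose (2 * r + 1)) =
    (2 * r + 3) * (2 * r + 2) * ((m + Suc r) choose (2 * r + 3))
    + (r + 1)\<^sup>2 * ((m + r) choose (2 * r + 1))"
proof (cases "m \<le> r")
  case True
  then have "(m + r) choose (2 * r + 1) = 0" "(m + Suc r) choose (2 * r + 3) = 0"
    by (simp_all del: add_Suc_right)
  then show ?thesis by (simp only: mult_0_right add_0)
next
  case False
  define C where "C = (m + r) choose (2 * r + 1)"
  have eqs: "2 * r + 3 = Suc (2 * r + 2)" "m + Suc r = Suc (m + r)" "2 * r + 2 = Suc (2 * r + 1)"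
    by simp_all
  have "(2 * r + 3) * (2 * r + 2) * ((m + Suc r) choose (2 * r + 3)) =
      (2 * r + 2) * (Suc (2 * r + 2) * (Suc (m + r) choose Suc (2 * r + 2)))"
    unfolding eqs(1,2) by (simp only: mult_ac)
  also have "\<dots> = Suc (m + r) * (Suc (2 * r + 1) * ((m + r) choose Suc (2 * r + 1)))"
    by (simp only: Suc_times_binomial) (simp add: eqs(3) algebra_simps)
  also have "\<dots> = Suc (m + r) * ((m + r - (2 * r + 1)) * C)"
    by (simp only: binomial_absorb_comp C_def flip: binomial_absorption)
  finally have "(2 * r + 3) * (2 * r + 2) * ((m + Suc r) choose (2 * r + 3)) =
      Suc (m + r) * ((m - Suc r) * C)" by simp
  moreover obtain d where "m = d + Suc r"
    using False by (metis add.commute less_imp_add_positive not_le add_Suc_right less_iff_Suc_add)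
  ultimately show ?thesis
    by (simp add: C_def algebra_simps power2_eq_square)
qed

lemma odd_power_eq_binomial_sum:
  "m ^ (2 * n + 1) = (\<Sum>r\<le>n. central_factorial n r * ((m + r) choose (2 * r + 1)))"
proof (induction n)
  case (Suc n)
  have "m ^ (2 * Suc n + 1) = (\<Sum>r\<le>n. central_factorial n r * (m\<^sup>2 * ((m + r) choose (2 * r + 1))))"
    using Suc by (simp add: power2_eq_square algebra_simps sum_distrib_left)
  also have "\<dots> = (\<Sum>r\<le>n. (2 * r + 3) * (2 * r + 2) * central_factorial n r * ((m + Suc r) choose (2 * r + 3)))
     + (\<Sum>r\<le>n. (r + 1)\<^sup>2 * central_factorial n r * ((m + r) choose (2 * r + 1)))"
    by (simp only: square_times_binomial flip: sum.distrib) (simp add: algebra_simps)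
  also have "(\<Sum>r\<le>n. (r + 1)\<^sup>2 * central_factorial n r * ((m + r) choose (2 * r + 1))) =
      (\<Sum>r\<le>Suc n. (r + 1)\<^sup>2 * central_factorial n r * ((m + r) choose (2 * r + 1)))"
    by (simp add: central_factorial_eq_0)
  \<comment> \<open>The index moves up by one; the new term \<open>r = 0\<close> vanishes because of
    the factor \<open>2 * r\<close>.\<close>
  also have "(\<Sum>r\<le>n. (2 * r + 3) * (2 * r + 2) * central_factorial n r * ((m + Suc r) choose (2 * r + 3)))
      = (\<Sum>r\<le>Suc n. (2 * r + 1) * (2 * r) * central_factorial n (r - 1) * ((m + r) choose (2 * r + 1)))"
    by (simp add: sum.atMost_Suc_shift numeral_eq_Suc del: sum.atMost_Suc)
  finally show ?case
    by (simp add: sum.distrib[symmetric] algebra_simps del: sum.atMost_Suc)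
qed simp

subsection \<open>Laurent polynomials as functions\<close>

definition laurent_monom :: "(nat \<Rightarrow>\<^sub>0 int) \<Rightarrow> fn" where
  "laurent_monom e x = (\<Prod>i\<in>Poly_Mapping.keys e. x i powi Poly_Mapping.lookup e i)"

lemma laurent_monom_superset:
  assumes "finite I" "Poly_Mapping.keys e \<subseteq> I"
  shows "laurent_monom e x = (\<Prod>i\<in>I. x i powi Poly_Mapping.lookup e i)"
  unfolding laurent_monom_def using assms
  by (intro prod.mono_neutral_left) (auto simp: in_keys_iff)

lemma laurent_monom_add:
  assumes "\<And>i. x i \<noteq> 0"
  shows "laurent_monom (d + e) x = laurent_monom d x * laurent_monom e x"
proof -
  let ?I = "Poly_Mapping.keys d \<union> Poly_Mapping.keys e"
  have "laurent_monom (d + e) x = (\<Prod>i\<in>?I. x i powi Poly_Mapping.lookup (d + e) i)"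
    by (rule laurent_monom_superset) (auto simp: keys_add)
  also have "\<dots> = (\<Prod>i\<in>?I. x i powi Poly_Mapping.lookup d i) * (\<Prod>i\<in>?I. x i powi Poly_Mapping.lookup e i)"
    by (simp add: lookup_add power_int_add assms prod.distrib)
  also have "\<dots> = laurent_monom d x * laurent_monom e x"
    by (simp add: laurent_monom_superset[where I = ?I])
  finally show ?thesis .
qed

lemma laurent_eval_superset:
  assumes "finite E" "Poly_Mapping.keys p \<subseteq> E"
  shows "laurent_eval p x = (\<Sum>e\<in>E. Poly_Mapping.lookup p e * laurent_monom e x)"
  unfolding laurent_eval_def laurent_monom_def using assms
  by (intro sum.mono_neutral_left) (auto simp: in_keys_iff)

lemma laurent_eval_add: "laurent_eval (p + q) x = laurent_eval p x + laurent_eval q x"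
proof -
  let ?E = "Poly_Mapping.keys p \<union> Poly_Mapping.keys q"
  have "laurent_eval (p + q) x = (\<Sum>e\<in>?E. Poly_Mapping.lookup (p + q) e * laurent_monom e x)"
    by (rule laurent_eval_superset) (auto simp: keys_add)
  also have "\<dots> = laurent_eval p x + laurent_eval q x"
    by (simp add: laurent_eval_superset[where E = ?E] lookup_add algebra_simps sum.distrib)
  finally show ?thesis .
qed

lemma laurent_eval_single: "laurent_eval (Poly_Mapping.single e c) x = c * laurent_monom e x"
  using laurent_eval_superset[of "{e}" "Poly_Mapping.single e c"] by simp

text \<open>Points with a zero coordinate are left out: there \<open>powi\<close> with a negative
  exponent takes the default value 0, and monomials are no longer multiplicative.\<close>

definition laurent_fn :: "fn \<Rightarrow> bool" where
  "laurent_fn f \<longleftrightarrow> (\<exists>p. \<forall>x. (\<forall>i. x i \<noteq> 0) \<longrightarrow> f x = laurent_eval p x)"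

lemma laurent_fn_monom: "laurent_fn (\<lambda>x. c * laurent_monom e x)"
  unfolding laurent_fn_def by (rule exI[of _ "Poly_Mapping.single e c"]) (simp add: laurent_eval_single)

lemma laurent_fn_cong:
  "laurent_fn f \<Longrightarrow> (\<And>x. (\<And>i. x i \<noteq> 0) \<Longrightarrow> g x = f x) \<Longrightarrow> laurent_fn g"
  unfolding laurent_fn_def by metis

lemma laurent_fn_const: "laurent_fn (\<lambda>x. c)"
  using laurent_fn_monom[of c 0] by (simp add: laurent_monom_def)

lemma laurent_fn_powi: "laurent_fn (\<lambda>x. x i powi m)"
  using laurent_fn_monom[of 1 "Poly_Mapping.single i m"] by (cases "m = 0") (simp_all add: laurent_monom_def)

lemma laurent_fn_add: "laurent_fn f \<Longrightarrow> laurent_fn g \<Longrightarrow> laurent_fn (\<lambda>x. f x + g x)"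
  unfolding laurent_fn_def by (metis laurent_eval_add)

lemma laurent_fn_sum: "(\<And>i. i \<in> I \<Longrightarrow> laurent_fn (f i)) \<Longrightarrow> laurent_fn (\<lambda>x. \<Sum>i\<in>I. f i x)"
  by (induction I rule: infinite_finite_induct) (auto intro: laurent_fn_const laurent_fn_add)

lemma laurent_fn_mult:
  assumes "laurent_fn f" "laurent_fn g"
  shows "laurent_fn (\<lambda>x. f x * g x)"
proof -
  obtain p q where f: "\<And>x. (\<And>i. x i \<noteq> 0) \<Longrightarrow> f x = laurent_eval p x"
    and g: "\<And>x. (\<And>i. x i \<noteq> 0) \<Longrightarrow> g x = laurent_eval q x"
    using assms unfolding laurent_fn_def by blast
  show ?thesis
  proof (rule laurent_fn_cong)
    show "laurent_fn (\<lambda>x. \<Sum>d\<in>Poly_Mapping.keys p. \<Sum>e\<in>Poly_Mapping.keys q.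
        (Poly_Mapping.lookup p d * Poly_Mapping.lookup q e) * laurent_monom (d + e) x)"
      by (intro laurent_fn_sum laurent_fn_monom)
    show "f x * g x = (\<Sum>d\<in>Poly_Mapping.keys p. \<Sum>e\<in>Poly_Mapping.keys q.
        (Poly_Mapping.lookup p d * Poly_Mapping.lookup q e) * laurent_monom (d + e) x)"
      if "\<And>i. x i \<noteq> 0" for x
      using that by (simp add: f g laurent_eval_superset[OF _ order_refl] sum_product laurent_monom_add
          mult_ac)
  qed
qed

lemma laurent_fn_prod: "(\<And>i. i \<in> I \<Longrightarrow> laurent_fn (f i)) \<Longrightarrow> laurent_fn (\<lambda>x. \<Prod>i\<in>I. f i x)"
  by (induction I rule: infinite_finite_induct) (auto intro: laurent_fn_const laurent_fn_mult)

lemma laurent_fn_power: "laurent_fn f \<Longrightarrow> laurent_fn (\<lambda>x. f x ^ n)"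
  by (induction n) (auto intro: laurent_fn_const laurent_fn_mult)

lemma laurent_fn_diff:
  assumes "laurent_fn f" "laurent_fn g"
  shows "laurent_fn (\<lambda>x. f x - g x)"
  using laurent_fn_add[OF assms(1) laurent_fn_mult[OF laurent_fn_const[of "-1"] assms(2)]] by simp

lemma laurent_fn_det:
  assumes "\<And>i j. i < n \<Longrightarrow> j < n \<Longrightarrow> laurent_fn (\<lambda>x. A x i j)"
  shows "laurent_fn (\<lambda>x. Determinant.det (Matrix.mat n n (\<lambda>(i, j). A x i j)))"
proof (rule laurent_fn_cong)
  show "laurent_fn (\<lambda>x. \<Sum>\<pi> | \<pi> permutes {0..<n}. of_int (sign \<pi>) * (\<Prod>i = 0..<n. A x i (\<pi> i)))"
    using assms permutes_in_image by (intro laurent_fn_sum laurent_fn_mult laurent_fn_const laurent_fn_prod) fastforce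
  show "Determinant.det (Matrix.mat n n (\<lambda>(i, j). A x i j)) =
      (\<Sum>\<pi> | \<pi> permutes {0..<n}. of_int (sign \<pi>) * (\<Prod>i = 0..<n. A x i (\<pi> i)))" for x
    by (subst det_def'[where n = n]) (auto intro!: sum.cong prod.cong simp: permutes_in_image)
qed

section \<open>Independence of Laurent monomials and uniqueness of coefficients\<close>

lemma powi_independent:
  fixes w :: "'a \<Rightarrow> int" and c :: "'a \<Rightarrow> complex"
  assumes "finite E" "inj_on w E" "e \<in> E"
    and zero: "\<And>t::real. 1 < t \<Longrightarrow> (\<Sum>e\<in>E. c e * of_real t powi w e) = 0"
  shows "c e = 0"
proof -
  \<comment> \<open>Multiplication by \<open>t powi K\<close> makes all exponents nonnegative, so
    that \<open>P\<close> is an ordinary polynomial with infinitely many zeros.\<close>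
  define K where "K = (\<Sum>e\<in>E. \<bar>w e\<bar>)"
  have K: "0 \<le> w e + K" if "e \<in> E" for e
    using member_le_sum[of e E "\<lambda>e. \<bar>w e\<bar>"] that assms(1) by (simp add: K_def)
  define P where "P = (\<Sum>e\<in>E. monom (c e) (nat (w e + K)))"
  have "poly P (of_real t) = 0" if "1 < t" for t :: real
  proof -
    have pow: "of_real t ^ nat (w e + K) = (of_real t powi w e * of_real t powi K :: complex)"
      if "e \<in> E" for e
    proof -
      have "of_real t ^ nat (w e + K) = (of_real t powi (w e + K) :: complex)"
        using K[OF that] by (simp only: int_nat_eq if_True flip: power_int_of_nat)
      then show ?thesis
        using \<open>1 < t\<close> by (subst (asm) power_int_add) auto
    qed
    have "poly P (of_real t) = (\<Sum>e\<in>E. c e * (of_real t powi w e * of_real t powi K))"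
      by (simp add: P_def poly_sum poly_monom pow)
    also have "\<dots> = of_real t powi K * (\<Sum>e\<in>E. c e * of_real t powi w e)"
      by (simp add: sum_distrib_left mult_ac)
    finally show ?thesis using zero[OF that] by simp
  qed
  then have "of_real ` {1::real<..} \<subseteq> {z. poly P z = 0}" by auto
  moreover have "infinite (of_real ` {1::real<..} :: complex set)"
    by (simp add: finite_image_iff inj_on_def infinite_Ioi)
  ultimately have "P = 0" using poly_roots_finite finite_subset by blast
  then have "0 = coeff P (nat (w e + K))" by simp
  also have "\<dots> = (\<Sum>d\<in>E. if d = e then c e else 0)"
    unfolding P_def coeff_sum
  proof (intro sum.cong refl)
    fix d assume "d \<in> E"
    show "coeff (monom (c d) (nat (w d + K))) (nat (w e + K)) = (if d = e then c e else 0)"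
      using K[OF \<open>d \<in> E\<close>] K[OF \<open>e \<in> E\<close>] inj_onD[OF assms(2) _ \<open>d \<in> E\<close> \<open>e \<in> E\<close>] by auto
  qed
  finally show ?thesis using assms(1,3) by simp
qed

text \<open>Kronecker substitution: for suitable \<open>B\<close>, finitely many monomials stay distinct under
  \<open>x i = t ^ B ^ Suc i\<close>.\<close>

lemma ex_separating_base:
  assumes "finite E"
  obtains B :: nat where "2 \<le> B"
    "inj_on (\<lambda>e. \<Sum>i\<in>Poly_Mapping.keys e. Poly_Mapping.lookup e i * int B ^ Suc i) E"
proof -
  \<comment> \<open>\<open>B\<close> times the value of \<open>W e\<close> at \<open>B\<close> is
    the exponent of \<open>t\<close> after the substitution. Two distinct exponent vectors collide
    only at the finitely many integer roots of a nonzero polynomial.\<close>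
  define W where "W = (\<lambda>e :: nat \<Rightarrow>\<^sub>0 int. \<Sum>i\<in>Poly_Mapping.keys e. monom (Poly_Mapping.lookup e i) i)"
  have coeff: "coeff (W e) i = Poly_Mapping.lookup e i" for e i
    by (auto simp: W_def coeff_sum in_keys_iff if_distrib cong: if_cong)
  define bad where "bad = (\<Union>(d, e)\<in>(E \<times> E) - Id. {B. poly (W d - W e) B = 0})"
  have "finite bad"
    unfolding bad_def using assms
  proof (intro finite_UN_I)
    fix de assume "de \<in> E \<times> E - Id"
    then have "W (fst de) - W (snd de) \<noteq> 0"
      by (auto simp: poly_eq_iff coeff intro: poly_mapping_eqI)
    then have "finite {B. poly (W (fst de) - W (snd de)) B = 0}"
      by (rule poly_roots_finite)
    then show "finite (case de of (d, e) \<Rightarrow> {B. poly (W d - W e) B = 0})"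
      by (simp only: split_def)
  qed auto
  then have "finite (int -` bad)" by (intro finite_vimageI) auto
  then have "infinite ({2..} - int -` bad)" by (simp add: infinite_Ici)
  then have "{2..} - int -` bad \<noteq> {}" by (metis finite.emptyI)
  then obtain B where B: "2 \<le> B" "int B \<notin> bad" by blast
  have "inj_on (\<lambda>e. \<Sum>i\<in>Poly_Mapping.keys e. Poly_Mapping.lookup e i * int B ^ Suc i) E"
  proof (rule inj_onI)
    fix d e
    assume de: "d \<in> E" "e \<in> E"
      "(\<Sum>i\<in>Poly_Mapping.keys d. Poly_Mapping.lookup d i * int B ^ Suc i) =
       (\<Sum>i\<in>Poly_Mapping.keys e. Poly_Mapping.lookup e i * int B ^ Suc i)"
    have "(\<Sum>i\<in>Poly_Mapping.keys e. Poly_Mapping.lookup e i * int B ^ Suc i) = int B * poly (W e) (int B)" for e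
      by (simp add: W_def poly_sum poly_monom sum_distrib_left mult_ac)
    then have "poly (W d - W e) (int B) = 0" using de(3) B(1) by simp
    then show "d = e" using B(2) de(1,2) by (auto simp: bad_def)
  qed
  then show ?thesis using that B(1) by blast
qed

text \<open>For a separating base the monomials of both sides become distinct powers of
  \<open>t\<close>, which are independent. The test points are restricted because the property
  defining \<open>sympl_char\<close> only concerns points where the denominator is nonzero.\<close>

lemma laurent_eqI:
  assumes "\<And>(t::real) (B::nat). 1 < t \<Longrightarrow> 2 \<le> B \<Longrightarrow>
    laurent_eval p (\<lambda>i. of_real t ^ B ^ Suc i) = laurent_eval q (\<lambda>i. of_real t ^ B ^ Suc i)"
  shows "p = q"
proof -
  define E where "E = Poly_Mapping.keys p \<union> Poly_Mapping.keys q"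
  have fin: "finite E" by (simp add: E_def)
  obtain B where B: "2 \<le> B"
    and inj: "inj_on (\<lambda>e. \<Sum>i\<in>Poly_Mapping.keys e. Poly_Mapping.lookup e i * int B ^ Suc i) E"
    using ex_separating_base[OF fin] by blast
  have "Poly_Mapping.lookup p e - Poly_Mapping.lookup q e = 0" if "e \<in> E" for e
  proof (rule powi_independent[OF fin inj that])
    fix t :: real assume t: "1 < t"
    define x :: "nat \<Rightarrow> complex" where "x = (\<lambda>i. of_real t ^ B ^ Suc i)"
    have mon: "laurent_monom e x =
        of_real t powi (\<Sum>i\<in>Poly_Mapping.keys e. Poly_Mapping.lookup e i * int B ^ Suc i)" for e
    proof -
      have pow: "x i powi m = of_real t powi (m * int B ^ Suc i)" for i m
      proof -
        have "x i = of_real t powi (int B ^ Suc i)"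
          unfolding x_def of_nat_power[symmetric] power_int_of_nat ..
        then show ?thesis by (simp only: mult.commute[of m] power_int_mult)
      qed
      have "(\<Prod>i\<in>I. of_real t powi f i) = (of_real t powi (\<Sum>i\<in>I. f i) :: complex)"
        if "finite I" for f and I :: "nat set"
        using that
      proof induction
        case (insert j I)
        have "of_real t \<noteq> (0 :: complex)" using t by simp
        then show ?case using insert by (simp only: prod.insert sum.insert power_int_add simp_thms)
      qed simp
      then show ?thesis
        by (simp only: laurent_monom_def pow finite_keys)
    qed
    have "(\<Sum>e\<in>E. (Poly_Mapping.lookup p e - Poly_Mapping.lookup q e) * laurent_monom e x) =
        laurent_eval p x - laurent_eval q x"
      using laurent_eval_superset[OF fin, of p x] laurent_eval_superset[OF fin, of q x]
      by (simp add: E_def left_diff_distrib sum_subtractf)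
    also have "\<dots> = 0"
      using assms[OF t B] by (simp only: x_def) simp
    finally show "(\<Sum>e\<in>E. (Poly_Mapping.lookup p e - Poly_Mapping.lookup q e) *
       of_real t powi (\<Sum>i\<in>Poly_Mapping.keys e. Poly_Mapping.lookup e i * int B ^ Suc i)) = 0"
      by (simp only: mon)
  qed
  then show ?thesis
    by (intro poly_mapping_eqI) (metis E_def UnCI eq_iff_diff_eq_0 in_keys_iff)
qed

subsection \<open>Symplectic characters as determinants\<close>

text \<open>The outer induction follows the quotients; the inner one descends in \<open>n\<close>
  from above \<open>degree p\<close>, where the coefficients vanish. The recursion only adds and
  multiplies.\<close>

lemma laurent_fn_coeff_newton_quot:
  assumes "\<And>r. laurent_fn (\<lambda>x. a x r)"
  shows "laurent_fn (\<lambda>x. coeff (newton_quot (a x) p s) n)"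
proof (induction s arbitrary: n)
  case 0
  show ?case by (simp add: laurent_fn_const)
next
  case (Suc s)
  show ?case
  proof (induction "Suc (degree p) - n" arbitrary: n rule: less_induct)
    case less
    show ?case
    proof (cases "degree p < n")
      case True
      then have "coeff (newton_quot (a x) p (Suc s)) n = 0" for x
        using degree_newton_quot[of "a x" p "Suc s"] by (intro coeff_eq_0) linarith
      then show ?thesis by (simp add: laurent_fn_const del: newton_quot.simps)
    next
      case False
      then have "laurent_fn (\<lambda>x. coeff (newton_quot (a x) p (Suc s)) (Suc n))"
        by (intro less) simp
      then have "laurent_fn (\<lambda>x. coeff (newton_quot (a x) p s) (Suc n) +
          a x s * coeff (newton_quot (a x) p (Suc s)) (Suc n))"
        by (intro laurent_fn_add laurent_fn_mult Suc assms)
      moreover have "coeff (newton_quot (a x) p (Suc s)) n = coeff (newton_quot (a x) p s) (Suc n) +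
          a x s * coeff (newton_quot (a x) p (Suc s)) (Suc n)" for x
        by (simp only: coeff_newton_quot_Suc[of "a x" p s n] diff_add_cancel)
      ultimately show ?thesis by simp
    qed
  qed
qed

text \<open>The degree of the quotient does not depend on the nodes, so its value is a sum over a
  range independent of \<open>x\<close>.\<close>

lemma laurent_fn_poly_newton_quot:
  assumes "\<And>r. laurent_fn (\<lambda>x. a x r)" "laurent_fn f"
  shows "laurent_fn (\<lambda>x. poly (newton_quot (a x) p s) (f x))"
  unfolding poly_altdef degree_newton_quot
  by (intro laurent_fn_sum laurent_fn_mult laurent_fn_coeff_newton_quot laurent_fn_power assms)

definition node :: "(nat \<Rightarrow> complex) \<Rightarrow> nat \<Rightarrow> complex" where
  "node x i = x i + inverse (x i) - 2"

lemma laurent_fn_node: "laurent_fn (\<lambda>x. node x i)"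
proof -
  have "laurent_fn (\<lambda>x. x i powi 1 + x i powi (-1) - 2)"
    by (intro laurent_fn_diff laurent_fn_add laurent_fn_powi laurent_fn_const)
  then show ?thesis by (simp add: node_def power_int_minus)
qed

lemma node_eq_iff:
  assumes "x i \<noteq> 0" "x j \<noteq> 0" "x i * x j \<noteq> 1"
  shows "node x i = node x j \<longleftrightarrow> x i = x j"
proof -
  have "node x i - node x j = (x i - x j) * (x i * x j - 1) / (x i * x j)"
    using assms by (simp add: node_def field_simps)
  then show ?thesis using assms by (metis diff_self eq_iff_diff_eq_0 divide_eq_0_iff mult_eq_0_iff)
qed

text \<open>The nodes are used in the order \<open>node x (L - 1), node x (L - 2), \<dots>\<close>, so that setting the last
  variables to 1 puts a multiple node 0 first, where divided differences are Taylor coefficients.\<close>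

definition sympl_entry :: "nat \<Rightarrow> (nat \<Rightarrow> nat) \<Rightarrow> (nat \<Rightarrow> complex) \<Rightarrow> nat \<Rightarrow> nat \<Rightarrow> complex" where
  "sympl_entry L \<mu> x l j =
     poly (newton_quot (\<lambda>r. node x (L - Suc r)) (odd_cheb (\<mu> j)) (L - Suc l)) (node x l)"

definition sympl_det :: "nat \<Rightarrow> (nat \<Rightarrow> nat) \<Rightarrow> fn" where
  "sympl_det L \<mu> x = Determinant.det (Matrix.mat L L (\<lambda>(l, j). sympl_entry L \<mu> x l j))"

lemma laurent_fn_sympl_det: "laurent_fn (sympl_det L \<mu>)"
  unfolding sympl_det_def sympl_entry_def
  by (intro laurent_fn_det laurent_fn_poly_newton_quot laurent_fn_node)

text \<open>Row \<open>l\<close> involves only the nodes with indices from \<open>l\<close> to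
  \<open>L - 1\<close>. If these are all 0, its entries are Taylor coefficients at 0.\<close>

lemma sympl_entry_node_zero:
  assumes "l < L" "\<And>i. l \<le> i \<Longrightarrow> i < L \<Longrightarrow> node x i = 0"
  shows "sympl_entry L \<mu> x l j = of_nat ((\<mu> j + (L - Suc l)) choose (2 * (L - Suc l) + 1))"
proof -
  have "coeff (newton_quot (\<lambda>r. node x (L - Suc r)) (odd_cheb (\<mu> j)) (L - Suc l)) 0 =
      coeff (odd_cheb (\<mu> j)) (L - Suc l + 0)"
    using assms by (intro coeff_newton_quot_zero_nodes) auto
  then show ?thesis
    using assms by (simp add: sympl_entry_def poly_0_coeff_0 coeff_odd_cheb)
qed

text \<open>Row \<open>i\<close> consists of divided differences of order \<open>L - Suc i\<close>,
  and column \<open>j\<close> belongs to a polynomial of degree at most \<open>L - Suc j\<close>. So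
  the entries above the diagonal vanish, and those on it are leading coefficients, equal to
  1.\<close>

lemma sympl_det_delta: "sympl_det L (delta L) x = 1"
proof -
  have entry: "sympl_entry L (delta L) x i j = of_nat ((L - j + (L - Suc i)) choose (2 * (L - Suc i) + 1))"
    if "i \<le> j" "j < L" for i j
  proof -
    have "degree (odd_cheb (delta L j)) \<le> L - Suc i"
      using degree_odd_cheb_le[of "delta L j"] that by (simp add: delta_def)
    then show ?thesis
      by (simp add: sympl_entry_def poly_newton_quot_top coeff_odd_cheb delta_def)
  qed
  have "sympl_det L (delta L) x = (\<Prod>i<L. sympl_entry L (delta L) x i i)"
    unfolding sympl_det_def by (rule det_mat_lower_triangular) (simp add: entry)
  also have "\<dots> = 1"
  proof (rule prod.neutral, safe)
    fix i assume "i < L"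
    then have "L - i + (L - Suc i) = 2 * (L - Suc i) + 1" by simp
    then show "sympl_entry L (delta L) x i i = 1"
      using \<open>i < L\<close> by (simp only: entry order_refl binomial_n_n) simp
  qed
  finally show ?thesis .
qed

text \<open>The matrix Z: rows with a variable hold the Newton basis, the others the coefficients of
  an odd power in the binomial basis.\<close>

definition mixed_cofactor :: "nat \<Rightarrow> nat \<Rightarrow> (nat \<Rightarrow> complex) \<Rightarrow> nat \<Rightarrow> nat \<Rightarrow> complex" where
  "mixed_cofactor L k x i l =
     (if i < k then (x i - inverse (x i)) * (\<Prod>r<L - Suc l. node x i - node x (L - Suc r))
      else of_nat (central_factorial (L - Suc i) (L - Suc l)))"

lemma a_mixed_factorization:
  assumes "k \<le> L" and nz: "\<And>i. i < k \<Longrightarrow> x i \<noteq> 0"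
  defines "y \<equiv> \<lambda>i. if i < k then x i else 1"
  shows "a_mixed L (k + 1) \<mu> x =
    Determinant.det (Matrix.mat L L (\<lambda>(i, l). mixed_cofactor L k y i l)) * sympl_det L \<mu> y"
  unfolding a_mixed_def sympl_det_def
proof (rule det_mat_mult)
  fix i j assume i: "i < L" and "j < L"
  define m where "m = \<mu> j"
  define N where "N = newton_quot (\<lambda>r. node y (L - Suc r)) (odd_cheb m)"
  have entry: "sympl_entry L \<mu> y l j = poly (N (L - Suc l)) (node y l)" for l
    by (simp add: sympl_entry_def m_def N_def)
  show "(if Suc i < k + 1 then x i powi int (\<mu> j) - x i powi - int (\<mu> j)
         else of_nat (\<mu> j) ^ (2 * (L - Suc i) + 1)) =
        (\<Sum>l<L. mixed_cofactor L k y i l * sympl_entry L \<mu> y l j)"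
  proof (cases "i < k")
    case True
    \<comment> \<open>\<open>node y i\<close> is itself one of the \<open>L\<close> nodes, so the
      remainder in Newton's formula disappears.\<close>
    have zero: "(\<Prod>r<L. node y i - node y (L - Suc r)) = 0"
      using i by (intro prod_zero bexI[of _ "L - Suc i"]) auto
    have "(\<Sum>l<L. mixed_cofactor L k y i l * sympl_entry L \<mu> y l j) =
        (\<Sum>l<L. (y i - inverse (y i)) * ((\<Prod>r<L - Suc l. node y i - node y (L - Suc r)) *
          poly (N (L - Suc l)) (node y (L - Suc (L - Suc l)))))"
      using True by (intro sum.cong refl) (simp add: mixed_cofactor_def entry)
    also have "\<dots> = (y i - inverse (y i)) * (\<Sum>s<L. (\<Prod>r<s. node y i - node y (L - Suc r)) *
          poly (N s) (node y (L - Suc s)))"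
      unfolding sum_distrib_left[symmetric] by (subst sum.nat_diff_reindex) simp
    also have "\<dots> = (y i - inverse (y i)) * poly (odd_cheb m) (node y i)"
      using newton_expansion[of "odd_cheb m" "node y i" "\<lambda>r. node y (L - Suc r)" L]
      by (simp add: zero N_def)
    also have "\<dots> = x i ^ m - inverse (x i) ^ m"
      using diff_inverse_power_eq_odd_cheb[of "x i" m] nz[OF True] True by (simp add: y_def node_def)
    finally show ?thesis
      using True by (simp add: m_def power_int_minus power_inverse)
  next
    case False
    have node: "node y l = 0" if "k \<le> l" for l
      using that by (simp add: y_def node_def)
    have "(\<Sum>l<L. mixed_cofactor L k y i l * sympl_entry L \<mu> y l j) =
        (\<Sum>l<L. of_nat (central_factorial (L - Suc i) (L - Suc l) *
           ((m + (L - Suc l)) choose (2 * (L - Suc l) + 1))))"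
    proof (intro sum.cong refl)
      fix l assume "l \<in> {..<L}"
      show "mixed_cofactor L k y i l * sympl_entry L \<mu> y l j =
        of_nat (central_factorial (L - Suc i) (L - Suc l) * ((m + (L - Suc l)) choose (2 * (L - Suc l) + 1)))"
      proof (cases "k \<le> l")
        case True
        then show ?thesis
          using False \<open>l \<in> _\<close> by (simp add: mixed_cofactor_def sympl_entry_node_zero node m_def)
      next
        \<comment> \<open>In these columns the second factor may depend on the variables, but
          \<open>L - Suc i < L - Suc l\<close> makes its coefficient 0.\<close>
        case l: False
        then have "central_factorial (L - Suc i) (L - Suc l) = 0"
          using False i by (intro central_factorial_eq_0) auto
        then show ?thesis
          using False by (simp add: mixed_cofactor_def)
      qed
    qed
    also have "\<dots> = (\<Sum>r<L. of_nat (central_factorial (L - Suc i) r * ((m + r) choose (2 * r + 1))))"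
      by (rule sum.nat_diff_reindex)
    also have "\<dots> = (\<Sum>r\<le>L - Suc i. of_nat (central_factorial (L - Suc i) r * ((m + r) choose (2 * r + 1))))"
      using i by (intro sum.mono_neutral_right) (auto simp: central_factorial_eq_0)
    also have "\<dots> = of_nat m ^ (2 * (L - Suc i) + 1)"
      by (simp only: odd_power_eq_binomial_sum flip: of_nat_power of_nat_sum)
    finally show ?thesis using False by (simp add: m_def)
  qed
qed

text \<open>Z is common to \<mu> and \<delta>, and \<open>sympl_det\<close> is 1 for \<delta>. The
  product form also covers points where the mixed determinants vanish.\<close>

lemma sympl_det_mult_a_mixed:
  assumes "k \<le> L" "\<And>i. i < k \<Longrightarrow> x i \<noteq> 0"
  shows "sympl_det L \<mu> (\<lambda>i. if i < k then x i else 1) * a_mixed L (k + 1) (delta L) x =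
    a_mixed L (k + 1) \<mu> x"
  by (simp only: a_mixed_factorization[OF assms] sympl_det_delta mult_1_left mult_1_right mult.commute)

lemma a_full_eq_a_mixed: "a_full L \<mu> x = a_mixed L (L + 1) \<mu> x"
  unfolding a_full_def a_mixed_def by (intro arg_cong[of _ _ Determinant.det] eq_matI) auto

lemma sympl_det_mult_a_full:
  assumes "\<And>i. x i \<noteq> 0"
  shows "sympl_det L \<mu> x * a_full L (delta L) x = a_full L \<mu> x"
proof -
  have "sympl_det L \<mu> (\<lambda>i. if i < L then x i else 1) = sympl_det L \<mu> x"
    unfolding sympl_det_def sympl_entry_def
  proof (intro arg_cong[of _ _ Determinant.det] eq_matI)
    \<comment> \<open>A quotient depends only on the nodes already divided out, so coordinates from
      \<open>L\<close> on do not enter the determinant.\<close>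
    have "newton_quot a p s = newton_quot b p s" if "\<And>r. r < s \<Longrightarrow> a r = b r"
      for a b :: "nat \<Rightarrow> complex" and p s
      using that by (induction s) auto
    note eq = this[of _ "\<lambda>r. node (\<lambda>i. if i < L then x i else 1) (L - Suc r)" "\<lambda>r. node x (L - Suc r)"]
    fix l j assume "l < dim_row (Matrix.mat L L (\<lambda>(l, j). poly (newton_quot (\<lambda>r. node x (L - Suc r))
      (odd_cheb (\<mu> j)) (L - Suc l)) (node x l)))" "j < dim_col (Matrix.mat L L (\<lambda>(l, j). poly
      (newton_quot (\<lambda>r. node x (L - Suc r)) (odd_cheb (\<mu> j)) (L - Suc l)) (node x l)))"
    then show "Matrix.mat L L (\<lambda>(l, j). poly (newton_quot (\<lambda>r. node (\<lambda>i. if i < L then x i else 1) (L - Suc r))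
        (odd_cheb (\<mu> j)) (L - Suc l)) (node (\<lambda>i. if i < L then x i else 1) l)) $$ (l, j) =
      Matrix.mat L L (\<lambda>(l, j). poly (newton_quot (\<lambda>r. node x (L - Suc r))
        (odd_cheb (\<mu> j)) (L - Suc l)) (node x l)) $$ (l, j)"
      using eq[of "L - Suc l"] by (simp add: node_def)
  qed auto
  then show ?thesis
    using sympl_det_mult_a_mixed[of L L x \<mu>] assms by (simp add: a_full_eq_a_mixed)
qed

text \<open>For \<delta> the determinant reduces to that of Z, which is upper triangular when all
  rows carry variables. Its diagonal gives the Weyl denominator product; the case
  \<open>i = j\<close> of the second assumption excludes \<open>x i = inverse (x i)\<close>.\<close>

lemma a_full_delta_nonzero:
  assumes "\<And>i. i < L \<Longrightarrow> x i \<noteq> 0" "\<And>i j. i < L \<Longrightarrow> j < L \<Longrightarrow> x i * x j \<noteq> 1" "inj_on x {..<L}"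
  shows "a_full L (delta L) x \<noteq> 0"
proof -
  define y where "y = (\<lambda>i. if i < L then x i else 1)"
  have "node y i \<noteq> node y j" if "i < j" "j < L" for i j
    using node_eq_iff[of y i j] inj_onD[OF assms(3), of i j] assms(1,2) that by (auto simp: y_def)
  then have prod: "(\<Prod>r<L - Suc i. node y i - node y (L - Suc r)) \<noteq> 0" if "i < L" for i
    using that by (auto simp: less_diff_conv)
  have "a_full L (delta L) x = Determinant.det (Matrix.mat L L (\<lambda>(i, l). mixed_cofactor L L y i l))"
    using a_mixed_factorization[of L L x "delta L"] assms(1)
    by (simp add: a_full_eq_a_mixed sympl_det_delta y_def)
  also have "\<dots> = (\<Prod>i<L. mixed_cofactor L L y i i)"
  proof (rule det_mat_upper_triangular)
    fix i l assume "i < L" "l < i"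
    then show "mixed_cofactor L L y i l = 0"
      by (auto simp: mixed_cofactor_def intro!: bexI[of _ "L - Suc i"])
  qed
  also have "\<dots> \<noteq> 0"
  proof -
    have "y i \<noteq> inverse (y i)" if "i < L" for i
      using assms(1,2)[OF that] that by (metis right_inverse y_def)
    then show ?thesis using prod by (auto simp: mixed_cofactor_def)
  qed
  finally show ?thesis .
qed

text \<open>\<open>sympl_det\<close> has the property that defines \<open>sympl_char\<close>, and
  \<open>laurent_eqI\<close> shows that nothing else has it. The formula then holds also where the
  denominator vanishes, in particular at (1, ..., 1).\<close>

lemma laurent_eval_sympl_char:
  assumes "\<And>i. x i \<noteq> 0"
  shows "laurent_eval (sympl_char L lam) x = sympl_det L (\<lambda>j. lam j + delta L j) x"
proof -
  define \<mu> where "\<mu> = (\<lambda>j. lam j + delta L j)"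
  obtain p where p: "\<And>x. (\<And>i. x i \<noteq> 0) \<Longrightarrow> sympl_det L \<mu> x = laurent_eval p x"
    using laurent_fn_sympl_det unfolding laurent_fn_def by blast
  have "sympl_char L lam = p"
    unfolding sympl_char_def \<mu>_def[symmetric]
  proof (rule the_equality)
    show "\<forall>x. (\<forall>i. x i \<noteq> 0) \<and> a_full L (delta L) x \<noteq> 0 \<longrightarrow>
        laurent_eval p x = a_full L \<mu> x / a_full L (delta L) x"
      using sympl_det_mult_a_full[of _ L \<mu>] p by (simp add: eq_divide_eq)
    fix q
    assume q: "\<forall>x. (\<forall>i. x i \<noteq> 0) \<and> a_full L (delta L) x \<noteq> 0 \<longrightarrow>
        laurent_eval q x = a_full L \<mu> x / a_full L (delta L) x"
    show "q = p"
    proof (rule laurent_eqI)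
      fix t :: real and B :: nat
      assume t: "1 < t" and B: "2 \<le> B"
      \<comment> \<open>The coordinates of a test point are distinct reals above 1, so the
        denominator is nonzero there.\<close>
      define x :: "nat \<Rightarrow> complex" where "x = (\<lambda>i. of_real t ^ B ^ Suc i)"
      have x: "x i = of_real (t ^ B ^ Suc i)" for i by (simp add: x_def)
      have gt: "1 < t ^ B ^ Suc i" for i
        using t B by (intro one_less_power) auto
      have nz: "x i \<noteq> 0" for i using t by (simp add: x_def)
      have "x i * x j \<noteq> 1" for i j
      proof -
        have "1 < t ^ B ^ Suc i * t ^ B ^ Suc j"
          using gt by (simp add: less_1_mult)
        then show ?thesis unfolding x of_real_mult[symmetric] of_real_eq_1_iff by linarith
      qed
      moreover have "inj x"
      proof (rule injI)
        fix i j assume "x i = x j"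
        then have "t ^ B ^ Suc i = t ^ B ^ Suc j" unfolding x of_real_eq_iff .
        then have "B ^ Suc i = B ^ Suc j" by (rule power_inject_exp[OF t, THEN iffD1])
        moreover have "1 < B" using B by simp
        ultimately show "i = j" using power_inject_exp by blast
      qed
      ultimately have "a_full L (delta L) x \<noteq> 0"
        by (intro a_full_delta_nonzero nz) (auto intro: inj_on_subset)
      then show "laurent_eval q (\<lambda>i. of_real t ^ B ^ Suc i) = laurent_eval p (\<lambda>i. of_real t ^ B ^ Suc i)"
        using q p[of x] sympl_det_mult_a_full[of x L \<mu>] nz
        unfolding x_def[symmetric] by (simp add: divide_eq_eq)
    qed
  qed
  then show ?thesis using p[of x] assms by (simp add: \<mu>_def)
qed

subsection \<open>The determinant of Euler operators\<close>

definition odd_power_det :: "nat \<Rightarrow> (nat \<Rightarrow> nat) \<Rightarrow> complex" where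
  "odd_power_det L \<mu> = Determinant.det (Matrix.mat L L (\<lambda>(i, j). of_nat (\<mu> j) ^ (2 * (L - Suc i) + 1)))"

lemma a_mixed_1: "a_mixed L 1 \<mu> x = odd_power_det L \<mu>"
  unfolding a_mixed_def odd_power_det_def by simp

text \<open>A null vector of the transposed matrix would be the coefficient vector of a nonzero
  polynomial of degree below \<open>L\<close> with the \<open>L\<close> distinct roots
  \<open>(\<mu> j)\<^sup>2\<close>. Positivity allows one factor \<open>\<mu> j\<close> to be
  cancelled.\<close>

lemma odd_power_det_nonzero:
  assumes inj: "inj_on \<mu> {..<L}" and pos: "\<And>j. j < L \<Longrightarrow> 0 < \<mu> j"
  shows "odd_power_det L \<mu> \<noteq> 0"
proof
  define M where "M = Matrix.mat L L (\<lambda>(j, i). of_nat (\<mu> j) ^ (2 * (L - Suc i) + 1) :: complex)"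
  assume "odd_power_det L \<mu> = 0"
  moreover have "Determinant.det M = odd_power_det L \<mu>"
    unfolding odd_power_det_def by (subst det_transpose[of M L, symmetric])
      (auto simp: M_def intro!: arg_cong[of _ _ Determinant.det] eq_matI)
  ultimately obtain v where v: "v \<in> carrier_vec L" "v \<noteq> 0\<^sub>v L" "M *\<^sub>v v = 0\<^sub>v L"
    using det_0_iff_vec_prod_zero[of M L] by (auto simp: M_def)
  define P where "P = (\<Sum>i<L. monom (vec_index v i) (L - Suc i))"
  have "poly P ((of_nat (\<mu> j))\<^sup>2) = 0" if "j < L" for j
  proof -
    have "of_nat (\<mu> j) * poly P ((of_nat (\<mu> j))\<^sup>2) = vec_index (M *\<^sub>v v) j"
      using that v(1) by (simp add: P_def M_def poly_sum poly_monom scalar_prod_def sum_distrib_left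
          atLeast0LessThan mult_ac flip: power_mult)
    then show ?thesis using pos[OF that] v(3) that by simp
  qed
  then have roots: "(\<lambda>j. (of_nat (\<mu> j))\<^sup>2) ` {..<L} \<subseteq> {z. poly P z = 0}" by auto
  have "inj_on (\<lambda>j. (of_nat (\<mu> j))\<^sup>2 :: complex) {..<L}"
  proof (rule inj_onI)
    fix i j assume ij: "i \<in> {..<L}" "j \<in> {..<L}" "(of_nat (\<mu> i))\<^sup>2 = ((of_nat (\<mu> j))\<^sup>2 :: complex)"
    then have "(\<mu> i)\<^sup>2 = (\<mu> j)\<^sup>2"
      by (simp only: of_nat_eq_iff flip: of_nat_power)
    then show "i = j" using inj_onD[OF inj _ ij(1,2)] by simp
  qed
  then have card: "card ((\<lambda>j. (of_nat (\<mu> j))\<^sup>2 :: complex) ` {..<L}) = L"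
    by (simp add: card_image)
  have coeff: "coeff P (L - Suc i) = vec_index v i" if "i < L" for i
  proof -
    have "coeff P (L - Suc i) = (\<Sum>l<L. if l = i then vec_index v i else 0)"
      unfolding P_def coeff_sum using that by (intro sum.cong) auto
    then show ?thesis using that by simp
  qed
  have "P = 0"
  proof (rule ccontr)
    assume "P \<noteq> 0"
    then have "L \<le> degree P"
      using card_mono[OF poly_roots_finite roots] card_poly_roots_bound[of P] card by simp
    moreover have "degree P \<le> L - 1"
      unfolding P_def by (intro degree_sum_le) (auto intro: order_trans[OF degree_monom_le])
    ultimately have "L = 0" by linarith
    then show False using \<open>P \<noteq> 0\<close> by (simp add: P_def)
  qed
  then have "v = 0\<^sub>v L" using coeff v(1) by (intro eq_vecI) auto
  with v(2) show False ..
qed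

text \<open>The cofactors of the first row do not involve that row.\<close>

lemma det_replace_first_row:
  fixes G :: "nat \<Rightarrow> nat \<Rightarrow> 'a::comm_ring_1"
  assumes "0 < n"
  shows "Determinant.det (Matrix.mat n n (\<lambda>(i, j). if i = 0 then f j else G i j)) =
    (\<Sum>j<n. f j * cofactor (Matrix.mat n n (\<lambda>(i, j). G i j)) 0 j)"
proof -
  define M where "M = Matrix.mat n n (\<lambda>(i, j). if i = 0 then f j else G i j)"
  have "mat_delete M 0 j = mat_delete (Matrix.mat n n (\<lambda>(i, j). G i j)) 0 j" if "j < n" for j
    by (rule eq_matI) (auto simp: M_def mat_delete_def)
  then have "(\<Sum>j<n. M $$ (0, j) * cofactor M 0 j) =
      (\<Sum>j<n. f j * cofactor (Matrix.mat n n (\<lambda>(i, j). G i j)) 0 j)"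
    using assms by (intro sum.cong) (auto simp: M_def cofactor_def)
  then show ?thesis
    using laplace_expansion_row[of M n 0] assms by (simp add: M_def)
qed

text \<open>\<open>A\<close> is the first column of the inverse of the odd power matrix, written
  with cofactors. Replacing the first row by row \<open>i\<close> yields the orthogonality
  relations; replacing it by the row of the variable yields \<phi>.\<close>

lemma phi_1_expansion:
  assumes "0 < L" and nz: "odd_power_det L \<mu> \<noteq> 0"
  obtains A where
    "\<And>i. i < L \<Longrightarrow> (\<Sum>l<L. of_nat (\<mu> l) ^ (2 * (L - Suc i) + 1) * A l) = (if i = 0 then 1 else 0)"
    "\<And>z. phi L \<mu> 1 (\<lambda>_. z) = (\<Sum>l<L. (z powi int (\<mu> l) - z powi - int (\<mu> l)) * A l)"
proof
  define G where "G = (\<lambda>i j. of_nat (\<mu> j) ^ (2 * (L - Suc i) + 1) :: complex)"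
  define A where "A = (\<lambda>l. cofactor (Matrix.mat L L (\<lambda>(i, j). G i j)) 0 l / odd_power_det L \<mu>)"
  have row: "(\<Sum>l<L. f l * A l) =
      Determinant.det (Matrix.mat L L (\<lambda>(i, j). if i = 0 then f j else G i j)) / odd_power_det L \<mu>" for f
    using det_replace_first_row[OF assms(1), of f G] by (simp add: A_def sum_divide_distrib)
  show "(\<Sum>l<L. of_nat (\<mu> l) ^ (2 * (L - Suc i) + 1) * A l) = (if i = 0 then 1 else 0)" if "i < L" for i
  proof (cases "i = 0")
    case True
    then have "Matrix.mat L L (\<lambda>(i', j). if i' = 0 then G i j else G i' j) =
        Matrix.mat L L (\<lambda>(i, j). G i j)"
      by (auto intro!: eq_matI)
    then show ?thesis
      using row[of "G i"] nz True by (simp add: odd_power_det_def G_def)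
  next
    case False
    then have "Determinant.det (Matrix.mat L L (\<lambda>(i', j). if i' = 0 then G i j else G i' j)) = 0"
      using that by (intro det_identical_rows[of _ L 0 i]) (auto intro!: eq_vecI)
    then show ?thesis
      using row[of "G i"] False by (simp add: G_def)
  qed
  show "phi L \<mu> 1 (\<lambda>_. z) = (\<Sum>l<L. (z powi int (\<mu> l) - z powi - int (\<mu> l)) * A l)" for z
    unfolding phi_def a_mixed_1 row
    by (auto simp: a_mixed_def G_def intro!: arg_cong[of _ _ Determinant.det] eq_matI
        arg_cong[of _ _ "\<lambda>d. d / odd_power_det L \<mu>"])
qed

text \<open>The result of applying z d/dz to \<phi>(z) \<open>p\<close> times, with \<open>A\<close>
  as coefficients; each application turns the sign of the second power.\<close>

definition odd_exp_sum :: "nat \<Rightarrow> (nat \<Rightarrow> nat) \<Rightarrow> (nat \<Rightarrow> complex) \<Rightarrow> nat \<Rightarrow> complex \<Rightarrow> complex" where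
  "odd_exp_sum L \<mu> A p z =
     (\<Sum>l<L. of_nat (\<mu> l) ^ p * (z powi int (\<mu> l) + (-1) ^ Suc p * z powi - int (\<mu> l)) * A l)"

lemma has_field_derivative_odd_exp_sum:
  assumes "z \<noteq> 0"
  shows "(odd_exp_sum L \<mu> A p has_field_derivative odd_exp_sum L \<mu> A (Suc p) z / z) (at z)"
proof -
  have powi: "((\<lambda>z. z powi n) has_field_derivative of_int n * z powi n / z) (at z)" for n
    using assms by (auto intro!: derivative_eq_intros simp: power_int_diff)
  have "((\<lambda>z. of_nat m ^ p * (z powi int m + (-1) ^ Suc p * z powi - int m) * c) has_field_derivative
      of_nat m ^ Suc p * (z powi int m + (-1) ^ Suc (Suc p) * z powi - int m) * c / z) (at z)"
    for m :: nat and c :: complex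
    by (rule DERIV_cong[OF DERIV_cmult_right[OF DERIV_cmult[OF DERIV_add[OF powi DERIV_cmult[OF powi]]]]])
      (simp add: algebra_simps diff_divide_distrib add_divide_distrib)
  then show ?thesis
    unfolding odd_exp_sum_def[abs_def] sum_divide_distrib by (intro DERIV_sum)
qed

section \<open>Euler operators on products of functions of one variable\<close>

lemma euler_D_prod:
  assumes g: "\<And>p z. z \<noteq> 0 \<Longrightarrow> (g p has_field_derivative g (Suc p) z / z) (at z)"
    and f: "\<And>y. (\<And>l. l < k \<Longrightarrow> y l \<noteq> 0) \<Longrightarrow> f y = (\<Prod>l<k. g (p l) (y l))"
    and "i < k" and y: "\<And>l. l < k \<Longrightarrow> y l \<noteq> 0"
  shows "euler_D i f y = (\<Prod>l<k. g ((p(i := Suc (p i))) l) (y l))"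
proof -
  define c where "c = (\<Prod>l\<in>{..<k} - {i}. g (p l) (y l))"
  \<comment> \<open>The product formula for \<open>f\<close> is known only off zero, but nonzero
    values form a neighbourhood of \<open>y i\<close>, which suffices for the derivative.\<close>
  have "eventually (\<lambda>z. z \<in> - {0}) (nhds (y i))"
    using y[OF \<open>i < k\<close>] by (intro eventually_nhds_in_open) auto
  then have "eventually (\<lambda>z. f (y(i := z)) = g (p i) z * c) (nhds (y i))"
  proof eventually_elim
    case (elim z)
    then have "f (y(i := z)) = (\<Prod>l<k. g (p l) ((y(i := z)) l))"
      using y by (intro f) auto
    also have "\<dots> = g (p i) z * (\<Prod>l\<in>{..<k} - {i}. g (p l) ((y(i := z)) l))"
      using \<open>i < k\<close> by (subst prod.remove[of _ i]) auto
    also have "(\<Prod>l\<in>{..<k} - {i}. g (p l) ((y(i := z)) l)) = c"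
      unfolding c_def by (intro prod.cong) auto
    finally show ?case .
  qed
  then have "deriv (\<lambda>z. f (y(i := z))) (y i) = deriv (\<lambda>z. g (p i) z * c) (y i)"
    by (rule deriv_cong_ev) simp
  also have "\<dots> = g (Suc (p i)) (y i) / y i * c"
    by (intro DERIV_imp_deriv DERIV_cmult_right g y \<open>i < k\<close>)
  finally have "euler_D i f y = g (Suc (p i)) (y i) * c"
    using y[OF \<open>i < k\<close>] by (simp add: euler_D_def)
  also have "c = (\<Prod>l\<in>{..<k} - {i}. g ((p(i := Suc (p i))) l) (y l))"
    unfolding c_def by (intro prod.cong) auto
  also have "g (Suc (p i)) (y i) * \<dots> = (\<Prod>l<k. g ((p(i := Suc (p i))) l) (y l))"
    using \<open>i < k\<close> by (subst (2) prod.remove[of _ i]) auto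
  finally show ?thesis .
qed

lemma euler_D_funpow_prod:
  assumes g: "\<And>p z. z \<noteq> 0 \<Longrightarrow> (g p has_field_derivative g (Suc p) z / z) (at z)"
    and f: "\<And>y. (\<And>l. l < k \<Longrightarrow> y l \<noteq> 0) \<Longrightarrow> f y = (\<Prod>l<k. g (p l) (y l))"
    and "i < k" and y: "\<And>l. l < k \<Longrightarrow> y l \<noteq> 0"
  shows "(euler_D i ^^ n) f y = (\<Prod>l<k. g ((p(i := p i + n)) l) (y l))"
  using y
proof (induction n arbitrary: y)
  case 0
  then show ?case by (simp add: f)
next
  case (Suc n)
  then show ?case
    using euler_D_prod[OF g Suc.IH \<open>i < k\<close> Suc.prems]
    by (simp add: fun_upd_same del: fun_upd_apply)
qed

lemma foldr_euler_D_prod: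
  assumes g: "\<And>p z. z \<noteq> 0 \<Longrightarrow> (g p has_field_derivative g (Suc p) z / z) (at z)"
    and f: "\<And>y. (\<And>l. l < k \<Longrightarrow> y l \<noteq> 0) \<Longrightarrow> f y = (\<Prod>l<k. g 0 (y l))"
    and "distinct is" "set is \<subseteq> {..<k}" and y: "\<And>l. l < k \<Longrightarrow> y l \<noteq> 0"
  shows "foldr (\<lambda>i. euler_D i ^^ e i) is f y = (\<Prod>l<k. g (if l \<in> set is then e l else 0) (y l))"
  using assms(3-)
proof (induction "is" arbitrary: y)
  case Nil
  then show ?case by (simp add: f)
next
  case (Cons i "is")
  have "foldr (\<lambda>i. euler_D i ^^ e i) (i # is) f y =
      (\<Prod>l<k. g (((\<lambda>l. if l \<in> set is then e l else 0)(i := (if i \<in> set is then e i else 0) + e i)) l) (y l))"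
    unfolding foldr.simps comp_apply
    using Cons by (intro euler_D_funpow_prod g) auto
  also have "\<dots> = (\<Prod>l<k. g (if l \<in> set (i # is) then e l else 0) (y l))"
    using Cons.prems by (intro prod.cong refl arg_cong2[of _ _ _ _ g]) auto
  finally show ?case .
qed

text \<open>In each Leibniz term every operator acts on its own factor, so the term becomes the
  corresponding product of matrix entries.\<close>

lemma op_det_euler_D_prod:
  assumes g: "\<And>p z. z \<noteq> 0 \<Longrightarrow> (g p has_field_derivative g (Suc p) z / z) (at z)"
    and f: "\<And>y. (\<And>l. l < k \<Longrightarrow> y l \<noteq> 0) \<Longrightarrow> f y = (\<Prod>l<k. g 0 (y l))"
    and x: "\<And>l. l < k \<Longrightarrow> x l \<noteq> 0"
  shows "op_det k (\<lambda>i j. euler_D i ^^ e j) f x =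
    Determinant.det (Matrix.mat k k (\<lambda>(i, j). g (e j) (x i)))"
proof -
  have "foldr (\<lambda>i. euler_D i ^^ e (\<pi> i)) [0..<k] f x = (\<Prod>i = 0..<k. g (e (\<pi> i)) (x i))" for \<pi>
    using foldr_euler_D_prod[OF g f, of "[0..<k]" x "\<lambda>i. e (\<pi> i)"] x by (auto simp: atLeast0LessThan intro!: prod.cong)
  moreover have "Determinant.det (Matrix.mat k k (\<lambda>(i, j). g (e j) (x i))) =
      (\<Sum>\<pi> | \<pi> permutes {0..<k}. of_int (sign \<pi>) * (\<Prod>i = 0..<k. g (e (\<pi> i)) (x i)))"
    by (subst det_def'[where n = k]) (auto intro!: sum.cong prod.cong simp: permutes_in_image)
  ultimately show ?thesis by (simp add: op_det_def)
qed

lemma det_odd_exp_sum: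
  assumes "k \<le> L"
    and A: "\<And>i. i < L \<Longrightarrow> (\<Sum>l<L. of_nat (\<mu> l) ^ (2 * (L - Suc i) + 1) * A l) = (if i = 0 then 1 else 0)"
  shows "odd_power_det L \<mu> * Determinant.det (Matrix.mat k k (\<lambda>(i, m). odd_exp_sum L \<mu> A (2 * m) (x i)))
    = a_mixed L (k + 1) \<mu> x"
proof -
  define N where "N = (\<lambda>l m. of_nat (\<mu> l) ^ (2 * m) * A l)"
  define X where "X = (\<lambda>i j. if Suc i < k + 1 then x i powi int (\<mu> j) - x i powi - int (\<mu> j)
     else of_nat (\<mu> j) ^ (2 * (L - Suc i) + 1))"
  \<comment> \<open>The factor \<open>of_nat (\<mu> l) ^ (2 * m)\<close> turns row \<open>i\<close>
    of the odd power matrix into row \<open>i - m\<close>, to which the relations for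
    \<open>A\<close> apply.\<close>
  have power_sum: "(\<Sum>l<L. of_nat (\<mu> l) ^ (2 * (L - Suc i) + 1) * N l m) = (if m = i then 1 else 0)"
    if "m \<le> i" "i < L" for i m
  proof -
    have "2 * (L - Suc i) + 1 + 2 * m = 2 * (L - Suc (i - m)) + 1" using that by simp
    then have "(\<Sum>l<L. of_nat (\<mu> l) ^ (2 * (L - Suc i) + 1) * N l m) =
        (\<Sum>l<L. of_nat (\<mu> l) ^ (2 * (L - Suc (i - m)) + 1) * A l)"
      unfolding N_def mult.assoc[symmetric] power_add[symmetric] by simp
    also have "\<dots> = (if m = i then 1 else 0)"
      using that by (subst A) auto
    finally show ?thesis .
  qed
  have "odd_power_det L \<mu> * Determinant.det (Matrix.mat L L (\<lambda>(l, m). N l m)) =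
      Determinant.det (Matrix.mat L L (\<lambda>(i, m). \<Sum>l<L. of_nat (\<mu> l) ^ (2 * (L - Suc i) + 1) * N l m))"
    unfolding odd_power_det_def by (rule det_mat_mult[symmetric]) simp
  also have "\<dots> = 1"
    using power_sum by (subst det_mat_block_upper_triangular[of 0]) auto
  finally have N: "odd_power_det L \<mu> * Determinant.det (Matrix.mat L L (\<lambda>(l, m). N l m)) = 1" .
  \<comment> \<open>The rows with variables become even Euler derivatives of \<phi>, while the
    remaining rows are unitriangular.\<close>
  have "a_mixed L (k + 1) \<mu> x * Determinant.det (Matrix.mat L L (\<lambda>(l, m). N l m)) =
      Determinant.det (Matrix.mat L L (\<lambda>(i, m). \<Sum>l<L. X i l * N l m))"
    unfolding a_mixed_def X_def by (rule det_mat_mult[symmetric]) simp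
  also have "\<dots> = Determinant.det (Matrix.mat k k (\<lambda>(i, m). \<Sum>l<L. X i l * N l m))"
    using power_sum \<open>k \<le> L\<close> by (intro det_mat_block_upper_triangular) (auto simp: X_def)
  also have "\<dots> = Determinant.det (Matrix.mat k k (\<lambda>(i, m). odd_exp_sum L \<mu> A (2 * m) (x i)))"
    by (intro arg_cong[of _ _ Determinant.det] eq_matI)
      (auto simp: X_def N_def odd_exp_sum_def mult_ac intro!: sum.cong)
  finally show ?thesis
    using N by (metis mult.assoc mult.commute mult_1_right)
qed

text \<open>The identity is pointwise, at points where the operator is defined: where
  \<open>phi L (delta L) k x\<close> is 0, the convention \<open>inverse 0 = 0\<close> would make
  the left side 0.\<close>

theorem proposition4p5p2:
  fixes L k :: nat and lam :: "nat \<Rightarrow> nat" and x :: "nat \<Rightarrow> complex"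
  assumes "1 \<le> k" and "k \<le> L"
    and partition: "\<And>i j. i \<le> j \<Longrightarrow> j < L \<Longrightarrow> lam j \<le> lam i"
    and "\<And>i. i < k \<Longrightarrow> x i \<noteq> 0"
    and "phi L (delta L) k x \<noteq> 0"
  shows "S_inv L k (\<lambda>y. \<Prod>i<k. q_char L lam (y i)) x =
         laurent_eval (sympl_char L lam) (\<lambda>i. if i < k then x i else 1)
         / laurent_eval (sympl_char L lam) (\<lambda>i. 1)"
proof -
  define \<mu> where "\<mu> = (\<lambda>j. lam j + delta L j)"
  define eval where "eval = laurent_eval (sympl_char L lam)"
  define \<epsilon> :: complex where "\<epsilon> = (-1) ^ (k * (k - 1) div 2)"
  have "0 < L" using assms(1,2) by simp
  have "\<mu> j < \<mu> i" if "i < j" "j < L" for i j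
    using partition[of i j] that by (simp add: \<mu>_def delta_def)
  then have "inj_on \<mu> {..<L}" by (intro linorder_inj_onI) fastforce+
  then have \<mu>_nz: "odd_power_det L \<mu> \<noteq> 0"
    by (rule odd_power_det_nonzero) (simp add: \<mu>_def delta_def)
  have \<delta>_nz: "odd_power_det L (delta L) \<noteq> 0"
    by (rule odd_power_det_nonzero) (auto simp: delta_def inj_on_def)
  have char: "eval (\<lambda>i. if i < m then y i else 1) * a_mixed L (m + 1) (delta L) y = a_mixed L (m + 1) \<mu> y"
    if "m \<le> L" "\<And>i. i < m \<Longrightarrow> y i \<noteq> 0" for m y
    using sympl_det_mult_a_mixed[OF that, where \<mu> = \<mu>]
      laurent_eval_sympl_char[of "\<lambda>i. if i < m then y i else 1" L lam] that(2)
    by (simp add: eval_def \<mu>_def)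
  \<comment> \<open>The case without variables is Weyl's dimension formula; it shows that the value
    at (1, ..., 1) is nonzero.\<close>
  have char_1: "eval (\<lambda>_. 1) * odd_power_det L (delta L) = odd_power_det L \<mu>"
    using char[of 0] by (simp add: a_mixed_1[simplified])
  then have eval_nz: "eval (\<lambda>_. 1) \<noteq> 0" using \<mu>_nz by auto
  have phi_ratio: "phi L \<mu> m y = phi L (delta L) m y * (eval (\<lambda>i. if i < m then y i else 1) / eval (\<lambda>_. 1))"
    if "m \<le> L" "\<And>i. i < m \<Longrightarrow> y i \<noteq> 0" for m y
    using \<delta>_nz unfolding phi_def a_mixed_1
    by (simp add: char_1[symmetric] char[OF that, symmetric, simplified] mult_ac)
  \<comment> \<open>The factors \<phi> of \<delta> inside the operator thus turn each
    \<open>q_char\<close> into \<phi> of \<mu>. With one variable only coordinate 0 is read, so a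
    constant function can represent \<open>z\<close>.\<close>
  have phi_q: "phi L (delta L) 1 (\<lambda>_. z) * q_char L lam z = phi L \<mu> 1 (\<lambda>_. z)" if "z \<noteq> 0" for z
    using phi_ratio[of 1 "\<lambda>_. z"] that \<open>0 < L\<close> by (simp add: q_char_def eval_def)
  obtain A where
    A: "\<And>i. i < L \<Longrightarrow> (\<Sum>l<L. of_nat (\<mu> l) ^ (2 * (L - Suc i) + 1) * A l) = (if i = 0 then 1 else 0)"
    and phi_1: "\<And>z. phi L \<mu> 1 (\<lambda>_. z) = (\<Sum>l<L. (z powi int (\<mu> l) - z powi - int (\<mu> l)) * A l)"
    using phi_1_expansion[OF \<open>0 < L\<close> \<mu>_nz] by blast
  define g where "g = odd_exp_sum L \<mu> A"
  have "op_det k (\<lambda>i j. euler_D i ^^ (2 * (k - Suc j)))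
       (\<lambda>y. (\<Prod>i<k. phi L (delta L) 1 (\<lambda>_. y i)) * (\<Prod>i<k. q_char L lam (y i))) x =
      Determinant.det (Matrix.mat k k (\<lambda>(i, j). g (2 * (k - Suc j)) (x i)))"
  proof (rule op_det_euler_D_prod)
    show "(g p has_field_derivative g (Suc p) z / z) (at z)" if "z \<noteq> 0" for p z
      unfolding g_def by (rule has_field_derivative_odd_exp_sum[OF that])
    show "(\<Prod>i<k. phi L (delta L) 1 (\<lambda>_. y i)) * (\<Prod>i<k. q_char L lam (y i)) = (\<Prod>l<k. g 0 (y l))"
      if "\<And>l. l < k \<Longrightarrow> y l \<noteq> 0" for y
      unfolding prod.distrib[symmetric] using that
      by (intro prod.cong refl) (simp add: phi_q[simplified] phi_1[simplified] g_def odd_exp_sum_def)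
  qed (rule assms)
  also have "\<dots> = \<epsilon> * Determinant.det (Matrix.mat k k (\<lambda>(i, j). g (2 * j) (x i)))"
    using det_reverse_columns[of k "\<lambda>i j. g (2 * j) (x i)"] by (simp add: \<epsilon>_def)
  also have "Determinant.det (Matrix.mat k k (\<lambda>(i, j). g (2 * j) (x i))) = phi L \<mu> k x"
    using det_odd_exp_sum[OF assms(2) A, of x] \<mu>_nz unfolding phi_def a_mixed_1 g_def
    by (simp add: eq_divide_eq mult.commute)
  finally have "S_inv L k (\<lambda>y. \<Prod>i<k. q_char L lam (y i)) x =
      (\<epsilon> * \<epsilon>) * (inverse (phi L (delta L) k x) * phi L \<mu> k x)"
    by (simp add: S_inv_def \<epsilon>_def)
  also have "\<epsilon> * \<epsilon> = 1" by (simp add: \<epsilon>_def flip: power_mult_distrib)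
  also have "inverse (phi L (delta L) k x) * phi L \<mu> k x = eval (\<lambda>i. if i < k then x i else 1) / eval (\<lambda>_. 1)"
    using phi_ratio[OF assms(2,4)] assms(5) by simp
  finally show ?thesis by (simp add: eval_def)
qed

end
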